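(* Assume (A1) the vectors $Y_1,Y_2,\dots$ are i.i.d. in $\mathbb{R}^K$ and $Y_i$ is independent of $\mathcal{F}_{i-1}$ for every $i\ge 1$; (A2) $\mathbb{E}[Y_1]=0$; (A3) $\mathbb{E}[\max_{1\le k\le K}|Y_{1,k}|]<\infty$. Then for every $n\ge 1$, $$\mathbb{E}[M_n]=\mathbb{E}\Bigl[\max_{1\le k\le K} S_{n,k}\Bigr]=\sum_{i=1}^n \mathbb{E}\bigl[\varphi_K(S_{i-1})\bigr].$$
   Context: Fix an integer $K\ge 1$ and a probability space $(\Omega,\mathcal{F},P)$. Let $X_1,X_2,\dots$ be i.i.d. random elements of a measurable space $\mathcal{X}$ (with generic copy $X$), and for $k\in\{1,\dots,K\}$ let $f_k:\mathcal{X}\to\mathbb{R}$ be measurable with mean $\mu_k=\mathbb{E}[f_k(X)]$. Put $Y_{i,k}=f_k(X_i)-\mu_k$ and $Y_i=(Y_{i,1},\dots,Y_{i,K})\in\mathbb{R}^K$ (the coordinates of $Y_i$ may be dependent). Let $S_{n,k}=\sum_{i=1}^n Y_{i,k}$, $S_n=(S_{n,1},\dots,S_{n,K})$, $S_0=(0,\dots,0)\in\mathbb{R}^K$, and $M_n=\max_{1\le k\le K}S_{n,k}$. The filtration is $\mathcal{F}_n=\sigma(X_1,\dots,X_n)$, with $\mathcal{F}_0=\{\emptyset,\Omega\}$. The selection premium function $\varphi_K:\mathbb{R}^K\to\mathbb{R}$ is $$\varphi_K(u)=\mathbb{E}\Bigl[\max_{1\le k\le K}(u_k+Y_k)\Bigr]-\max_{1\le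 k\le K}u_k,$$ where $Y=(Y_1,\dots,Y_K)$ inside this formula denotes a random vector with the same distribution as the increment vector $(Y_{1,1},\dots,Y_{1,K})$. *)

theory Defs
  imports "HOL-Probability.Probability"
begin

text \<open>
  The \<open>K \<ge> 1\<close> arms are the elements of a finite index type \<open>'k\<close> (so \<open>K = CARD('k)\<close>, and
  \<open>K \<ge> 1\<close> since types are inhabited); vectors in \<open>\<real>\<^sup>K\<close> have type \<^typ>\<open>real ^ 'k\<close>.
  The sequence \<open>X 1, X 2, \<dots>\<close> starts at index 1; \<open>X 0\<close> is never used.
\<close>

definition vmax :: "real ^ 'k::finite \<Rightarrow> real" where
  "vmax u = (MAX k. u $ k)"

definition arm_mean :: "'a measure \<Rightarrow> (nat \<Rightarrow> 'a \<Rightarrow> 'x) \<Rightarrow> ('k::finite \<Rightarrow> 'x \<Rightarrow> real) \<Rightarrow> 'k \<Rightarrow> real" where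
  "arm_mean M X f k = (\<integral>\<omega>. f k (X 1 \<omega>) \<partial>M)"

definition increment ::
    "'a measure \<Rightarrow> (nat \<Rightarrow> 'a \<Rightarrow> 'x) \<Rightarrow> ('k::finite \<Rightarrow> 'x \<Rightarrow> real) \<Rightarrow> nat \<Rightarrow> 'a \<Rightarrow> real ^ 'k" where
  "increment M X f i \<omega> = (\<chi> k. f k (X i \<omega>) - arm_mean M X f k)"

definition walk ::
    "'a measure \<Rightarrow> (nat \<Rightarrow> 'a \<Rightarrow> 'x) \<Rightarrow> ('k::finite \<Rightarrow> 'x \<Rightarrow> real) \<Rightarrow> nat \<Rightarrow> 'a \<Rightarrow> real ^ 'k" where
  "walk M X f n \<omega> = (\<Sum>i = 1..n. increment M X f i \<omega>)"

definition walk_max ::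
    "'a measure \<Rightarrow> (nat \<Rightarrow> 'a \<Rightarrow> 'x) \<Rightarrow> ('k::finite \<Rightarrow> 'x \<Rightarrow> real) \<Rightarrow> nat \<Rightarrow> 'a \<Rightarrow> real" where
  "walk_max M X f n \<omega> = vmax (walk M X f n \<omega>)"

text \<open>For \<open>n = 0\<close> the generating family is empty, which gives the trivial \<open>\<sigma>\<close>-algebra.\<close>

definition history :: "'a measure \<Rightarrow> 'x measure \<Rightarrow> (nat \<Rightarrow> 'a \<Rightarrow> 'x) \<Rightarrow> nat \<Rightarrow> 'a measure" where
  "history M N X n = sigma (space M) (\<Union>i\<in>{1..n}. {X i -` A \<inter> space M | A. A \<in> sets N})"

definition increment_law ::
    "'a measure \<Rightarrow> (nat \<Rightarrow> 'a \<Rightarrow> 'x) \<Rightarrow> ('k::finite \<Rightarrow> 'x \<Rightarrow> real) \<Rightarrow> (real ^ 'k) measure" where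
  "increment_law M X f = distr M borel (increment M X f 1)"

text \<open>
  The random vector inside the expectation enters only through its law \<open>D\<close>; it is integrated out
  separately from \<open>u\<close>, so that \<open>u\<close> may be replaced by a random point.
\<close>

definition selection_premium :: "(real ^ 'k::finite) measure \<Rightarrow> real ^ 'k \<Rightarrow> real" where
  "selection_premium D u = (\<integral>y. vmax (u + y) \<partial>D) - vmax u"

end

theory Submission
  imports Defs
begin

text \<open>
  Conditionally on \<open>S\<^bsub>i-1\<^esub>\<close>, the independent increment \<open>Y\<^sub>i\<close> raises the maximum by
  \<open>\<phi>\<^sub>K (S\<^bsub>i-1\<^esub>)\<close> on average (Fubini on the product law of \<open>(S\<^bsub>i-1\<^esub>, Y\<^sub>i)\<close>). Hence the sum of
  the expected premia telescopes to \<open>E M\<^sub>n - E M\<^sub>0\<close>, and \<open>M\<^sub>0 = 0\<close>. Every integrability claim follows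
  from the coordinatewise maximum being 1-Lipschitz.
\<close>

text \<open>Each \<open>u $ k\<close> exceeds \<open>v $ k\<close>, hence also
  \<open>vmax v\<close>, by at most \<open>norm (u - v)\<close>; exchanging \<open>u\<close> and
  \<open>v\<close> gives the other half.\<close>

lemma vmax_lipschitz: "\<bar>vmax u - vmax v\<bar> \<le> norm (u - v)"
proof -
  have le: "vmax u \<le> vmax v + norm (u - v)" for u v :: "real ^ 'k::finite"
    unfolding vmax_def
  proof (rule Max.boundedI)
    fix a assume "a \<in> range (($) u)"
    then obtain k where a: "a = u $ k" by auto
    have "u $ k - v $ k \<le> norm (u - v)"
      using component_le_norm_cart[of "u - v" k] by simp
    moreover have "v $ k \<le> (MAX k. v $ k)" by (intro Max_ge) auto
    ultimately show "a \<le> (MAX k. v $ k) + norm (u - v)" using a by linarith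
  qed auto
  show ?thesis using le[of u v] le[of v u] by (simp add: norm_minus_commute abs_le_iff)
qed

lemma vmax_zero [simp]: "vmax 0 = 0"
  by (simp add: vmax_def)

lemma abs_vmax_le_norm: "\<bar>vmax u\<bar> \<le> norm u"
  using vmax_lipschitz[of u 0] by simp

lemma borel_measurable_vmax [measurable]: "vmax \<in> borel_measurable borel"
proof (intro borel_measurable_continuous_onI)
  have "1-lipschitz_on UNIV vmax"
    by (intro lipschitz_onI) (simp_all add: dist_norm vmax_lipschitz)
  then show "continuous_on UNIV vmax" by (rule lipschitz_on_continuous_on)
qed

lemma integrable_vmax:
  assumes "integrable M U"
  shows "integrable M (\<lambda>\<omega>. vmax (U \<omega>))"
proof (rule Bochner_Integration.integrable_bound)
  show "integrable M (\<lambda>\<omega>. norm (U \<omega>))" using assms by simp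
  have [measurable]: "U \<in> borel_measurable M" using assms by simp
  show "(\<lambda>\<omega>. vmax (U \<omega>)) \<in> borel_measurable M" by measurable
  show "AE \<omega> in M. norm (vmax (U \<omega>)) \<le> norm (norm (U \<omega>))"
    by (simp add: abs_vmax_le_norm)
qed

text \<open>The Euclidean norm is dominated by the sum of the absolute coordinates. This turns means
  given arm by arm into integrability of the whole vector.\<close>

lemma integrable_vec:
  fixes U :: "'a \<Rightarrow> real ^ 'k::finite"
  assumes [measurable]: "U \<in> borel_measurable M" and int: "\<And>k. integrable M (\<lambda>\<omega>. U \<omega> $ k)"
  shows "integrable M U"
proof (rule Bochner_Integration.integrable_bound)
  show "integrable M (\<lambda>\<omega>. \<Sum>k\<in>UNIV. \<bar>U \<omega> $ k\<bar>)"
    using int by (intro Bochner_Integration.integrable_sum integrable_abs)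
  show "AE \<omega> in M. norm (U \<omega>) \<le> norm (\<Sum>k\<in>UNIV. \<bar>U \<omega> $ k\<bar>)"
    by (simp add: norm_le_l1_cart sum_nonneg)
qed simp

context prob_space
begin

text \<open>The sum and \<open>Y i\<close> are measurable functions of the restrictions of the
  family to the disjoint index sets \<open>I\<close> and \<open>{i}\<close>, and such restrictions
  are independent.\<close>

lemma indep_var_sum_vec:
  fixes Y :: "'i \<Rightarrow> 'a \<Rightarrow> 'b::euclidean_space"
  assumes "finite I" "i \<notin> I" and indep: "indep_vars (\<lambda>_. borel) Y (insert i I)"
  shows "indep_var borel (\<lambda>\<omega>. \<Sum>j\<in>I. Y j \<omega>) borel (Y i)"
proof -
  have "indep_var borel ((\<lambda>y. \<Sum>j\<in>I. y j) \<circ> (\<lambda>\<omega>. restrict (\<lambda>j. Y j \<omega>) I))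
                  borel ((\<lambda>y. y i) \<circ> (\<lambda>\<omega>. restrict (\<lambda>j. Y j \<omega>) {i}))"
    using assms by (intro indep_var_compose[OF indep_var_restrict[OF indep]]) auto
  then show ?thesis by (simp add: comp_def cong: sum.cong)
qed

text \<open>One step of the telescoping sum, with \<open>U\<close> as the current position and
  \<open>Y\<close> as the next increment. Averaging over the law of \<open>Y\<close> at a fixed
  point and then over \<open>U\<close> amounts to averaging over the pair.\<close>

lemma expectation_selection_premium:
  fixes U Y :: "'a \<Rightarrow> real ^ 'k::finite"
  assumes indep: "indep_var borel U borel Y" and U: "integrable M U" and Y: "integrable M Y"
  shows "integrable M (\<lambda>\<omega>. selection_premium (distr M borel Y) (U \<omega>))" (is ?int)
    and "expectation (\<lambda>\<omega>. selection_premium (distr M borel Y) (U \<omega>)) =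
      expectation (\<lambda>\<omega>. vmax (U \<omega> + Y \<omega>)) - expectation (\<lambda>\<omega>. vmax (U \<omega>))" (is ?eq)
proof -
  let ?P = "distr M borel U" and ?Q = "distr M borel Y"
  have [measurable]: "U \<in> borel_measurable M" "Y \<in> borel_measurable M"
    using U Y by auto
  interpret P: prob_space ?P by (rule prob_space_distr) simp
  interpret Q: prob_space ?Q by (rule prob_space_distr) simp
  interpret PQ: pair_sigma_finite ?P ?Q ..
  \<comment> \<open>Independence enters here: the joint law is the product of the marginals.\<close>
  have law: "?P \<Otimes>\<^sub>M ?Q = distr M (borel \<Otimes>\<^sub>M borel) (\<lambda>\<omega>. (U \<omega>, Y \<omega>))"
    using indep by (simp add: indep_var_distribution_eq)
  have g [measurable]: "(\<lambda>(u, y). vmax (u + y) :: real) \<in> borel_measurable (borel \<Otimes>\<^sub>M (borel :: (real ^ 'k) measure))"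
    by measurable
  have "integrable M (\<lambda>\<omega>. vmax (U \<omega> + Y \<omega>))"
    using U Y by (intro integrable_vmax) simp
  \<comment> \<open>Fubini for a signed integrand needs integrability on the product; it is carried
    over from \<open>M\<close>, where \<open>U + Y\<close> is integrable.\<close>
  then have joint: "integrable (?P \<Otimes>\<^sub>M ?Q) (\<lambda>(u, y). vmax (u + y))"
    unfolding law by (subst integrable_distr_eq) auto
  have "integrable ?P (\<lambda>u. \<integral>y. vmax (u + y) \<partial>?Q)"
    using PQ.integrable_fst'[OF joint] by simp
  then have inner: "integrable M (\<lambda>\<omega>. \<integral>y. vmax (U \<omega> + y) \<partial>?Q)"
    by (rule integrable_distr[rotated]) simp
  then show ?int
    unfolding selection_premium_def using integrable_vmax[OF U]
    by (rule Bochner_Integration.integrable_diff)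
  have "expectation (\<lambda>\<omega>. \<integral>y. vmax (U \<omega> + y) \<partial>?Q) = (\<integral>u. \<integral>y. vmax (u + y) \<partial>?Q \<partial>?P)"
    by (subst integral_distr) auto
  also have "\<dots> = (\<integral>z. (\<lambda>(u, y). vmax (u + y)) z \<partial>(?P \<Otimes>\<^sub>M ?Q))"
    using PQ.integral_fst'[OF joint] by simp
  also have "\<dots> = expectation (\<lambda>\<omega>. vmax (U \<omega> + Y \<omega>))"
    unfolding law by (subst integral_distr) auto
  finally show ?eq
    unfolding selection_premium_def using inner integrable_vmax[OF U] by simp
qed

end

theorem theorem3p1:
  fixes M :: "'a measure" and N :: "'x measure"
    and X :: "nat \<Rightarrow> 'a \<Rightarrow> 'x" and f :: "'k::finite \<Rightarrow> 'x \<Rightarrow> real"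
    and n :: nat
  assumes prob: "prob_space M"
    and X_indep: "prob_space.indep_vars M (\<lambda>_. N) X {1..}"
    and X_ident: "\<And>i. i \<ge> 1 \<Longrightarrow> distr M N (X i) = distr M N (X 1)"
    and f_meas: "\<And>k. f k \<in> borel_measurable N"
    and f_mean: "\<And>k. integrable M (\<lambda>\<omega>. f k (X 1 \<omega>))"
    and A1_indep: "prob_space.indep_vars M (\<lambda>_. borel) (increment M X f) {1..}"
    and A1_ident: "\<And>i. i \<ge> 1 \<Longrightarrow> distr M borel (increment M X f i) = increment_law M X f"
    and A1_past: "\<And>i. i \<ge> 1 \<Longrightarrow>
      prob_space.indep_set M
        (sets (vimage_algebra (space M) (increment M X f i) borel))
        (sets (history M N X (i - 1)))"
    and A2: "(\<integral>\<omega>. increment M X f 1 \<omega> \<partial>M) = 0"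
    and A3: "integrable M (\<lambda>\<omega>. MAX k. \<bar>increment M X f 1 \<omega> $ k\<bar>)"
    and n: "n \<ge> 1"
  shows "integrable M (walk_max M X f n)
    \<and> (\<forall>u. integrable (increment_law M X f) (\<lambda>y. vmax (u + y)))
    \<and> (\<forall>i\<in>{1..n}. integrable M
          (\<lambda>\<omega>. selection_premium (increment_law M X f) (walk M X f (i - 1) \<omega>)))
    \<and> (\<integral>\<omega>. walk_max M X f n \<omega> \<partial>M) = (\<integral>\<omega>. (MAX k. walk M X f n \<omega> $ k) \<partial>M)
    \<and> (\<integral>\<omega>. (MAX k. walk M X f n \<omega> $ k) \<partial>M)
        = (\<Sum>i = 1..n. \<integral>\<omega>. selection_premium (increment_law M X f) (walk M X f (i - 1) \<omega>) \<partial>M)"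
proof -
  interpret prob_space M by (rule prob)
  let ?Y = "increment M X f" and ?S = "walk M X f" and ?D = "increment_law M X f"
  have Ym: "?Y i \<in> borel_measurable M" if "i \<ge> 1" for i
    using A1_indep that by (auto simp: indep_vars_def)
  \<comment> \<open>Each coordinate is \<open>f k (X 1 \<omega>)\<close> shifted by a constant,
    which is integrable under a probability measure.\<close>
  have Y1: "integrable M (?Y 1)"
    using Ym[of 1] f_mean by (intro integrable_vec) (auto simp: increment_def)
  \<comment> \<open>Integrability of the identity depends on the law alone, so it passes from the
    first increment to every \<open>?Y i\<close> with the same law.\<close>
  have D: "integrable ?D (\<lambda>y. y)"
    unfolding increment_law_def using Ym[of 1] Y1 by (subst integrable_distr_eq) auto
  have Y: "integrable M (?Y i)" if "i \<ge> 1" for i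
    using D Ym[OF that] unfolding A1_ident[OF that, symmetric]
    by (subst (asm) integrable_distr_eq) auto
  have S: "integrable M (?S i)" for i
    unfolding walk_def using Y by (intro Bochner_Integration.integrable_sum) simp
  have S_Suc: "?S (Suc i) \<omega> = ?S i \<omega> + ?Y (Suc i) \<omega>" for i \<omega>
    by (simp add: walk_def)
  \<comment> \<open>\<open>?S i\<close> uses the indices \<open>{1..i}\<close> only, and
    \<open>Suc i\<close> lies outside; for \<open>i = 0\<close> the sum is empty.\<close>
  have indep: "indep_var borel (?S i) borel (?Y (Suc i))" for i
    unfolding walk_def
    by (intro indep_var_sum_vec indep_vars_subset[OF A1_indep]) auto
  have premium: "integrable M (\<lambda>\<omega>. selection_premium ?D (?S i \<omega>))"
    "expectation (\<lambda>\<omega>. selection_premium ?D (?S i \<omega>)) =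
      expectation (\<lambda>\<omega>. vmax (?S (Suc i) \<omega>)) - expectation (\<lambda>\<omega>. vmax (?S i \<omega>))" for i
    \<comment> \<open>The premium arises with the law of \<open>?Y (Suc i)\<close>;
      \<open>A1_ident\<close> replaces it by \<open>?D\<close>, so one function serves every step
      and the sum telescopes.\<close>
    using expectation_selection_premium[OF indep[of i] S Y[of "Suc i"]]
    by (simp_all add: A1_ident S_Suc)
  have "(\<Sum>i = 1..n. expectation (\<lambda>\<omega>. selection_premium ?D (?S (i - 1) \<omega>)))
      = (\<Sum>i<n. expectation (\<lambda>\<omega>. selection_premium ?D (?S i \<omega>)))"
    by (rule sum.reindex_bij_witness[of _ Suc "\<lambda>i. i - 1"]) auto
  also have "\<dots> = expectation (\<lambda>\<omega>. vmax (?S n \<omega>)) - expectation (\<lambda>\<omega>. vmax (?S 0 \<omega>))"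
    unfolding premium(2) by (rule sum_lessThan_telescope)
  \<comment> \<open>The walk at time 0 is an empty sum, so the initial term is the expectation of
    \<open>vmax 0 = 0\<close>.\<close>
  also have "\<dots> = expectation (\<lambda>\<omega>. MAX k. ?S n \<omega> $ k)"
    unfolding vmax_def[symmetric] by (simp add: walk_def)
  finally have sum: "expectation (\<lambda>\<omega>. MAX k. ?S n \<omega> $ k) =
      (\<Sum>i = 1..n. expectation (\<lambda>\<omega>. selection_premium ?D (?S (i - 1) \<omega>)))" by simp
  interpret D: prob_space ?D
    unfolding increment_law_def by (rule prob_space_distr) (simp add: Ym)
  have "integrable ?D (\<lambda>y. vmax (u + y))" for u
    using D by (intro integrable_vmax Bochner_Integration.integrable_add) simp_all
  moreover have "integrable M (walk_max M X f n)"
    using integrable_vmax[OF S] by (simp add: walk_max_def[abs_def])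
  ultimately show ?thesis
    using premium(1) sum by (simp add: walk_max_def vmax_def)
qed

end
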